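(* Let $B_w$ be a hypercyclic weighted backward shift on $X=\ell^p$, $1\le p<\infty$, or $X=c_0$, considered as a Banach sequence algebra under coordinatewise multiplication. Then the set $HC(B_w)$ of hypercyclic vectors for $B_w$ is algebrable. This applies, in particular, to the Rolewicz operators $\lambda B$ with $\lambda\in\mathbb{C}$, $|\lambda|>1$.
   Context: $\ell^p$ and $c_0$ are the classical Banach spaces of complex sequences $x=(x_n)_{n\ge0}$ with their usual norms; coordinatewise multiplication is $xy=(x_ny_n)_n$. A weight is a sequence $w=(w_n)_{n\ge0}$ of non-zero complex numbers, with the convention $w_0=1$. The weighted backward shift is $B_w(x_0,x_1,x_2,\dots)=(w_1x_1,w_2x_2,w_3x_3,\dots)$; saying that it is a weighted backward shift on $X$ means that it maps $X$ into $X$ (it is then a continuous linear operator on $X$). $B$ is the unweighted shift $B(x_0,x_1,\dots)=(x_1,x_2,\dots)$. $HC(T)=\{x\in X:\{x,Tx,T^2x,\dots\}\text{ is dense in }X\}$, and $T$ is hypercyclic if $HC(T)\neq\varnothing$. $HC(T)$ is algebrable if $HC(T)\cup\{0\}$ contains a subalgebra of $X$ that is infinitely but not finitely generated. Algebras are not required to be unital; the algebra generated by a set is the smallest subalgebra containing it (the linear span of all finite products of at least one element of the set), and an algebra is finitely generated if it is generated by a finite subset. *)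

theory Defs
  imports "HOL-Analysis.Analysis" "HOL-Library.Function_Algebras"
begin

text \<open>Sequences are functions \<^typ>\<open>nat \<Rightarrow> complex\<close>. Addition, subtraction and multiplication of
  sequences are pointwise (\<^theory>\<open>HOL-Library.Function_Algebras\<close>); in particular the product is
  coordinatewise multiplication.\<close>

type_synonym cseq = "nat \<Rightarrow> complex"

definition lp :: "real \<Rightarrow> cseq set" where
  "lp p = {x. summable (\<lambda>n. norm (x n) powr p)}"

definition lp_norm :: "real \<Rightarrow> cseq \<Rightarrow> real" where
  "lp_norm p x = (\<Sum>n. norm (x n) powr p) powr (1 / p)"

definition c0 :: "cseq set" where
  "c0 = {x. x \<longlonglongrightarrow> 0}"

definition c0_norm :: "cseq \<Rightarrow> real" where
  "c0_norm x = (SUP n. norm (x n))"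

definition lp_or_c0 :: "cseq set \<Rightarrow> (cseq \<Rightarrow> real) \<Rightarrow> bool" where
  "lp_or_c0 X N \<longleftrightarrow> (\<exists>p\<ge>1. X = lp p \<and> N = lp_norm p) \<or> (X = c0 \<and> N = c0_norm)"

text \<open>The locale \<^locale>\<open>Metric_space\<close> asks for nonnegative distances also outside the carrier,
  where the norms above are unspecified; hence the case distinction.\<close>

definition norm_dist :: "cseq set \<Rightarrow> (cseq \<Rightarrow> real) \<Rightarrow> cseq \<Rightarrow> cseq \<Rightarrow> real" where
  "norm_dist X N x y = (if x \<in> X \<and> y \<in> X then N (x - y) else 0)"

definition norm_topology :: "cseq set \<Rightarrow> (cseq \<Rightarrow> real) \<Rightarrow> cseq topology" where
  "norm_topology X N = Metric_space.mtopology X (norm_dist X N)"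

definition weight :: "cseq \<Rightarrow> bool" where
  "weight w \<longleftrightarrow> w 0 = 1 \<and> (\<forall>n. w n \<noteq> 0)"

definition weighted_shift :: "cseq \<Rightarrow> cseq \<Rightarrow> cseq" where
  "weighted_shift w x = (\<lambda>n. w (Suc n) * x (Suc n))"

definition weighted_shift_on :: "cseq set \<Rightarrow> cseq \<Rightarrow> bool" where
  "weighted_shift_on X w \<longleftrightarrow> weight w \<and> weighted_shift w ` X \<subseteq> X"

definition backward_shift :: "cseq \<Rightarrow> cseq" where
  "backward_shift x = (\<lambda>n. x (Suc n))"

definition rolewicz :: "complex \<Rightarrow> cseq \<Rightarrow> cseq" where
  "rolewicz c x = (\<lambda>n. c * backward_shift x n)"

definition HC :: "cseq set \<Rightarrow> (cseq \<Rightarrow> real) \<Rightarrow> (cseq \<Rightarrow> cseq) \<Rightarrow> cseq set" where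
  "HC X N T = {x \<in> X. norm_topology X N closure_of (range (\<lambda>k. (T ^^ k) x)) = X}"

definition hypercyclic :: "cseq set \<Rightarrow> (cseq \<Rightarrow> real) \<Rightarrow> (cseq \<Rightarrow> cseq) \<Rightarrow> bool" where
  "hypercyclic X N T \<longleftrightarrow> HC X N T \<noteq> {}"

text \<open>Algebras are complex and not required to be unital.\<close>

definition subalgebra_of :: "cseq set \<Rightarrow> cseq set \<Rightarrow> bool" where
  "subalgebra_of X A \<longleftrightarrow> A \<subseteq> X \<and> 0 \<in> A \<and> (\<forall>x\<in>A. \<forall>y\<in>A. x + y \<in> A) \<and>
     (\<forall>c. \<forall>x\<in>A. (\<lambda>n. c * x n) \<in> A) \<and> (\<forall>x\<in>A. \<forall>y\<in>A. x * y \<in> A)"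

definition algebra_generated :: "cseq set \<Rightarrow> cseq set \<Rightarrow> cseq set" where
  "algebra_generated X G = subalgebra_of X hull G"

definition algebrable :: "cseq set \<Rightarrow> cseq set \<Rightarrow> bool" where
  "algebrable X S \<longleftrightarrow> (\<exists>A. subalgebra_of X A \<and> A \<subseteq> S \<union> {0} \<and>
     (\<exists>G\<subseteq>X. infinite G \<and> A = algebra_generated X G) \<and>
     \<not> (\<exists>G\<subseteq>X. finite G \<and> A = algebra_generated X G))"

text \<open>The sequence spaces are algebras under coordinatewise multiplication, and the norms induce
  metrics on them.\<close>

lemma powr_weighted_mean_le:
  fixes s t u v p :: real
  assumes "p \<ge> 1" "s \<ge> 0" "t \<ge> 0" "u \<ge> 0" "v \<ge> 0" "u + v = 1"
  shows "(u * s + v * t) powr p \<le> u * s powr p + v * t powr p"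
proof -
  have le: "a powr p \<le> a" if "0 \<le> a" "a \<le> 1" for a :: real
  proof (cases "a = 0")
    case False
    then have "a powr p \<le> a powr 1"
      using that assms(1) by (intro powr_mono') auto
    then show ?thesis using that by simp
  qed (use assms in auto)
  consider "s = 0" | "t = 0" | "s > 0" "t > 0" using assms by linarith
  then show ?thesis
  proof cases
    case 1
    then show ?thesis using le[of v] assms
      by (auto simp: powr_mult intro: mult_right_mono)
  next
    case 2
    then show ?thesis using le[of u] assms
      by (auto simp: powr_mult intro: mult_right_mono)
  next
    case 3
    then show ?thesis
      using convex_onD[OF powr_convex[OF assms(1)], of v s t] assms
      by (simp add: algebra_simps flip: eq_diff_eq)
  qed
qed

lemma lp_norm_nonneg: "0 \<le> lp_norm p x"
  by (simp add: lp_norm_def)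

lemma lp_norm_powr:
  assumes "p \<ge> 1" "x \<in> lp p"
  shows "lp_norm p x powr p = (\<Sum>n. norm (x n) powr p)"
  using assms by (simp add: lp_norm_def lp_def powr_powr suminf_nonneg)

lemma lp_norm_eq_0_iff:
  assumes "p \<ge> 1" "x \<in> lp p"
  shows "lp_norm p x = 0 \<longleftrightarrow> x = 0"
proof -
  have "lp_norm p x = 0 \<longleftrightarrow> (\<Sum>n. norm (x n) powr p) = 0"
    by (simp add: lp_norm_def)
  also have "\<dots> \<longleftrightarrow> (\<forall>n. norm (x n) powr p = 0)"
    using assms(2) by (intro suminf_eq_zero_iff) (auto simp: lp_def)
  finally show ?thesis by (auto simp: fun_eq_iff)
qed

lemma lp_add:
  assumes p: "p \<ge> 1" and x: "x \<in> lp p" and y: "y \<in> lp p"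
  shows "x + y \<in> lp p" and "lp_norm p (x + y) \<le> lp_norm p x + lp_norm p y"
proof -
  define a b where "a = lp_norm p x" and "b = lp_norm p y"
  have "x + y \<in> lp p \<and> lp_norm p (x + y) \<le> a + b"
  proof (cases "a = 0 \<or> b = 0")
    case True
    then have "x = 0 \<or> y = 0" using assms by (auto simp: a_def b_def lp_norm_eq_0_iff)
    then show ?thesis
      using x y lp_norm_nonneg[of p x] lp_norm_nonneg[of p y] by (auto simp: a_def b_def)
  next
    case False
    then have ab: "a > 0" "b > 0"
      using lp_norm_nonneg[of p x] lp_norm_nonneg[of p y] by (auto simp: a_def b_def)
    define u v where "u = a / (a + b)" and "v = b / (a + b)"
    have uv: "u \<ge> 0" "v \<ge> 0" "u + v = 1"
      using ab by (auto simp: u_def v_def simp flip: add_divide_distrib)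
    let ?M = "(a + b) powr p"
    let ?h = "\<lambda>n. ?M * (u * (norm (x n) powr p / a powr p) + v * (norm (y n) powr p / b powr p))"
    have le: "norm ((x + y) n) powr p \<le> ?h n" for n
    proof -
      have "norm ((x + y) n) powr p \<le> (norm (x n) + norm (y n)) powr p"
        using p by (intro powr_mono2) (auto simp: norm_triangle_ineq)
      also have "norm (x n) + norm (y n) = (a + b) * (u * (norm (x n) / a) + v * (norm (y n) / b))"
        using ab by (simp add: u_def v_def distrib_left)
      also have "\<dots> powr p = ?M * (u * (norm (x n) / a) + v * (norm (y n) / b)) powr p"
        by (rule powr_mult)
      also have "\<dots> \<le> ?M * (u * (norm (x n) / a) powr p + v * (norm (y n) / b) powr p)"
        using ab uv p by (intro mult_left_mono powr_weighted_mean_le) auto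
      also have "\<dots> = ?h n"
        using ab by (simp add: powr_divide)
      finally show ?thesis .
    qed
    have sx: "(\<lambda>n. norm (x n) powr p) sums (a powr p)"
      using x lp_norm_powr[OF p x] by (simp add: lp_def a_def summable_sums)
    have sy: "(\<lambda>n. norm (y n) powr p) sums (b powr p)"
      using y lp_norm_powr[OF p y] by (simp add: lp_def b_def summable_sums)
    have "?h sums (?M * (u * (a powr p / a powr p) + v * (b powr p / b powr p)))"
      by (intro sums_mult sums_add sums_divide sx sy)
    then have h: "?h sums ?M" using ab uv by simp
    have s: "summable (\<lambda>n. norm ((x + y) n) powr p)"
      by (rule summable_comparison_test'[OF sums_summable[OF h], of 0]) (use le in auto)
    then have mem: "x + y \<in> lp p" by (simp add: lp_def)
    have "(\<Sum>n. norm ((x + y) n) powr p) \<le> ?M"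
      using suminf_le[OF le s sums_summable[OF h]] sums_unique[OF h] by simp
    then have "lp_norm p (x + y) \<le> ?M powr (1 / p)"
      unfolding lp_norm_def using p s by (intro powr_mono2 suminf_nonneg) auto
    also have "\<dots> = a + b" using p ab by (simp add: powr_powr)
    finally show ?thesis using mem by simp
  qed
  then show "x + y \<in> lp p" "lp_norm p (x + y) \<le> lp_norm p x + lp_norm p y"
    by (auto simp: a_def b_def)
qed

lemma lp_scale:
  assumes "x \<in> lp p"
  shows "(\<lambda>n. c * x n) \<in> lp p"
  using assms by (auto simp: lp_def norm_mult powr_mult intro: summable_mult)

lemma lp_diff:
  assumes "p \<ge> 1" "x \<in> lp p" "y \<in> lp p"
  shows "x - y \<in> lp p"
proof -
  have "- y \<in> lp p" using assms(3) by (simp add: lp_def)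
  from lp_add(1)[OF assms(1,2) this] show ?thesis by simp
qed

lemma lp_mult:
  assumes "p \<ge> 1" "x \<in> lp p" "y \<in> lp p"
  shows "x * y \<in> lp p"
proof -
  have "(\<lambda>n. norm (y n) powr p) \<longlonglongrightarrow> 0"
    using assms(3) by (auto simp: lp_def intro: summable_LIMSEQ_zero)
  then have "Bseq (\<lambda>n. norm (y n) powr p)" by (auto intro: convergent_imp_Bseq convergentI)
  then obtain K where K: "\<And>n. norm (norm (y n) powr p) \<le> K" by (metis BseqE)
  have s: "summable (\<lambda>n. norm (x n) powr p * K)"
    using assms(2) by (auto simp: lp_def intro: summable_mult2)
  have "summable (\<lambda>n. norm ((x * y) n) powr p)"
    by (rule summable_comparison_test'[OF s, of 0])
       (use K in \<open>auto simp: norm_mult powr_mult intro!: mult_left_mono\<close>)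
  then show ?thesis by (simp add: lp_def)
qed

lemma subalgebra_lp: "p \<ge> 1 \<Longrightarrow> subalgebra_of (lp p) (lp p)"
  using lp_add(1) lp_scale lp_mult by (auto simp: subalgebra_of_def) (simp add: lp_def)

lemma subalgebra_c0: "subalgebra_of c0 c0"
  by (auto simp: subalgebra_of_def c0_def plus_fun_def times_fun_def zero_fun_def
           intro: tendsto_add_zero tendsto_mult_right_zero tendsto_mult_zero)

lemma Metric_space_lp:
  assumes p: "p \<ge> 1"
  shows "Metric_space (lp p) (norm_dist (lp p) (lp_norm p))"
proof
  fix x y z :: cseq
  show "0 \<le> norm_dist (lp p) (lp_norm p) x y"
    by (simp add: norm_dist_def lp_norm_nonneg)
  show "norm_dist (lp p) (lp_norm p) x y = norm_dist (lp p) (lp_norm p) y x"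
    by (simp add: norm_dist_def lp_norm_def norm_minus_commute)
  assume x: "x \<in> lp p" and y: "y \<in> lp p"
  show "norm_dist (lp p) (lp_norm p) x y = 0 \<longleftrightarrow> x = y"
    using x y lp_norm_eq_0_iff[OF p lp_diff[OF p x y]] by (simp add: norm_dist_def)
  assume z: "z \<in> lp p"
  show "norm_dist (lp p) (lp_norm p) x z \<le>
          norm_dist (lp p) (lp_norm p) x y + norm_dist (lp p) (lp_norm p) y z"
    using lp_add(2)[OF p lp_diff[OF p x y] lp_diff[OF p y z]] x y z by (simp add: norm_dist_def)
qed

lemma c0_norm_upper: "x \<in> c0 \<Longrightarrow> norm (x n) \<le> c0_norm x"
  unfolding c0_norm_def c0_def
  by (intro cSUP_upper) (auto intro!: bounded_imp_bdd_above Bseq_eq_bounded[THEN iffD1]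
        convergent_imp_Bseq convergentI tendsto_norm_zero)

lemma c0_norm_least: "(\<And>n. norm (x n) \<le> K) \<Longrightarrow> c0_norm x \<le> K"
  unfolding c0_norm_def by (intro cSUP_least) auto

lemma Metric_space_c0: "Metric_space c0 (norm_dist c0 c0_norm)"
proof
  have diff: "x - y \<in> c0" if "x \<in> c0" "y \<in> c0" for x y
    using that tendsto_diff[of x 0 sequentially y 0] by (simp add: c0_def fun_diff_def)
  fix x y z :: cseq
  show "0 \<le> norm_dist c0 c0_norm x y"
    using c0_norm_upper[OF diff, of x y 0] by (auto simp: norm_dist_def intro: order_trans[OF norm_ge_zero])
  show "norm_dist c0 c0_norm x y = norm_dist c0 c0_norm y x"
    by (simp add: norm_dist_def c0_norm_def norm_minus_commute)
  assume x: "x \<in> c0" and y: "y \<in> c0"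
  show "norm_dist c0 c0_norm x y = 0 \<longleftrightarrow> x = y"
  proof
    assume "norm_dist c0 c0_norm x y = 0"
    then have "norm ((x - y) n) \<le> 0" for n
      using c0_norm_upper[OF diff[OF x y], of n] x y by (simp add: norm_dist_def)
    then show "x = y" by (simp add: fun_eq_iff)
  qed (simp add: norm_dist_def c0_norm_def)
  assume z: "z \<in> c0"
  have "c0_norm (x - z) \<le> c0_norm (x - y) + c0_norm (y - z)"
  proof (rule c0_norm_least)
    fix n
    have "norm ((x - z) n) \<le> norm ((x - y) n) + norm ((y - z) n)"
      using norm_triangle_ineq[of "(x - y) n" "(y - z) n"] by simp
    also have "\<dots> \<le> c0_norm (x - y) + c0_norm (y - z)"
      using diff x y z by (intro add_mono c0_norm_upper)
    finally show "norm ((x - z) n) \<le> c0_norm (x - y) + c0_norm (y - z)" .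
  qed
  then show "norm_dist c0 c0_norm x z \<le> norm_dist c0 c0_norm x y + norm_dist c0 c0_norm y z"
    using x y z by (simp add: norm_dist_def)
qed

end

theory Submission
  imports Defs
begin

text \<open>Fix one bounded sequence \<open>x\<close> and consider the algebra \<open>A\<close> spanned by its powers \<open>x\<^sup>q\<close> with rational
  \<open>q \<ge> 1\<close>. Hypercyclicity makes the weight products \<open>v\<^sub>n = w\<^sub>1 \<cdots> w\<^sub>n\<close> large on long blocks of
  indices. On sparse blocks starting at \<open>n\<^sub>k\<close>, put \<open>x\<^bsub>n\<^sub>k + j\<^esub> = (y\<^sub>j v\<^sub>j / v\<^bsub>n\<^sub>k + j\<^esub>)\<^bsup>1/s\<^esup>\<close>, where
  the pairs of an exponent \<open>s\<close> and a finitely supported \<open>y\<close> run through a countable dense family,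
  each pair infinitely often. If \<open>s\<close> is the least exponent in a combination \<open>\<Sum> c\<^sub>q x\<^sup>q\<close>, then
  shifting it by \<open>n\<^sub>k\<close> gives approximately \<open>c\<^sub>s y\<close>: higher powers are negligible on the block, and
  the later blocks are too small to be seen. So all nonzero elements of \<open>A\<close> are hypercyclic; in
  particular the powers are linearly independent, and since no exponent
  below 2 is a sum of two exponents, \<open>A\<close> is not finitely generated.\<close>

section \<open>Common properties of l^p and c_0\<close>

text \<open>Besides the metric axioms and truncation, all that is asked of the norm is that the l^1
  norm bounds it and that it bounds each coordinate. Errors can thus be estimated in l^1 for all the
  spaces at once.\<close>

locale seq_space =
  fixes X :: "cseq set" and N :: "cseq \<Rightarrow> real"
  assumes metric: "Metric_space X (norm_dist X N)"
    and subalgebra: "subalgebra_of X X"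
    and l1_mem: "summable (\<lambda>n. norm (x n)) \<Longrightarrow> x \<in> X"
    and l1_norm: "summable (\<lambda>n. norm (x n)) \<Longrightarrow> N x \<le> (\<Sum>n. norm (x n))"
    and coord_le: "x \<in> X \<Longrightarrow> norm (x n) \<le> N x"
    and null_seq: "x \<in> X \<Longrightarrow> x \<longlonglongrightarrow> 0"
    and truncation: "x \<in> X \<Longrightarrow> e > 0 \<Longrightarrow> \<exists>m. N (x - (\<lambda>n. if n < m then x n else 0)) < e"
    and shift_mem: "x \<in> X \<Longrightarrow> backward_shift x \<in> X"

text \<open>With S the l^1 norm, |x_n| \<le> S gives |x_n|^p \<le> S^(p-1) |x_n|, and summation
  yields S^p.\<close>

lemma lp_l1:
  assumes p: "p \<ge> 1" and x: "summable (\<lambda>n. norm (x n))"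
  shows "x \<in> lp p" and "lp_norm p x \<le> (\<Sum>n. norm (x n))"
proof -
  define S where "S = (\<Sum>n. norm (x n))"
  have S0: "S \<ge> 0" unfolding S_def by (intro suminf_nonneg x) auto
  have le: "norm (x n) powr p \<le> S powr (p - 1) * norm (x n)" for n
  proof -
    have "norm (x n) \<le> S"
      unfolding S_def using sum_le_suminf[OF x, of "{n}"] by simp
    then have "norm (x n) powr (p - 1) * norm (x n) \<le> S powr (p - 1) * norm (x n)"
      using p by (intro mult_right_mono powr_mono2) auto
    moreover have "norm (x n) powr p = norm (x n) powr (p - 1) * norm (x n)"
      using p powr_mult_base[of "norm (x n)" "p - 1"] by (simp add: mult.commute)
    ultimately show ?thesis by simp
  qed
  have s: "summable (\<lambda>n. norm (x n) powr p)"
    by (rule summable_comparison_test'[OF summable_mult[OF x], of 0]) (use le in auto)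
  then show "x \<in> lp p" by (simp add: lp_def)
  have "(\<Sum>n. norm (x n) powr p) \<le> (\<Sum>n. S powr (p - 1) * norm (x n))"
    by (intro suminf_le le s summable_mult x)
  also have "\<dots> = S powr (p - 1) * S" by (simp add: S_def suminf_mult x)
  also have "\<dots> = S powr p" using p S0 powr_mult_base[of S "p - 1"] by (simp add: mult.commute)
  finally have "lp_norm p x \<le> (S powr p) powr (1 / p)"
    unfolding lp_norm_def using p s by (intro powr_mono2 suminf_nonneg) auto
  also have "\<dots> = S" using p S0 by (simp add: powr_powr)
  finally show "lp_norm p x \<le> (\<Sum>n. norm (x n))" by (simp add: S_def)
qed

lemma lp_coord_le:
  assumes p: "p \<ge> 1" and x: "x \<in> lp p"
  shows "norm (x n) \<le> lp_norm p x"
proof -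
  have s: "summable (\<lambda>n. norm (x n) powr p)" using x by (simp add: lp_def)
  have "norm (x n) powr p \<le> (\<Sum>n. norm (x n) powr p)"
    using sum_le_suminf[OF s, of "{n}"] by simp
  then have "(norm (x n) powr p) powr (1 / p) \<le> lp_norm p x"
    unfolding lp_norm_def using p by (intro powr_mono2) auto
  then show ?thesis using p by (simp add: powr_powr)
qed

lemma lp_null_seq:
  assumes p: "p \<ge> 1" and x: "x \<in> lp p"
  shows "x \<longlonglongrightarrow> 0"
proof -
  have "(\<lambda>n. norm (x n) powr p) \<longlonglongrightarrow> 0"
    using x by (simp add: lp_def summable_LIMSEQ_zero)
  then have "(\<lambda>n. (norm (x n) powr p) powr (1 / p)) \<longlonglongrightarrow> 0 powr (1 / p)"
    using p by (intro tendsto_powr' tendsto_const) auto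
  then show ?thesis using p by (simp add: powr_powr tendsto_norm_zero_iff)
qed

lemma lp_truncation:
  assumes p: "p \<ge> 1" and x: "x \<in> lp p" and e: "e > 0"
  shows "\<exists>m. lp_norm p (x - (\<lambda>n. if n < m then x n else 0)) < e"
proof -
  have s: "summable (\<lambda>n. norm (x n) powr p)" using x by (simp add: lp_def)
  obtain m where m: "norm (\<Sum>i. norm (x (i + m)) powr p) < e powr p"
    using suminf_exist_split[OF _ s, of "e powr p"] e by auto
  let ?t = "\<lambda>n. norm ((x - (\<lambda>n. if n < m then x n else 0)) n) powr p"
  have st: "summable ?t"
    by (rule summable_comparison_test'[OF s, of 0]) auto
  have "(\<Sum>n. ?t n) = (\<Sum>i. norm (x (i + m)) powr p)"
    using suminf_split_initial_segment[OF st, of m] by simp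
  then have "(\<Sum>n. ?t n) < e powr p" using m by simp
  then have "(\<Sum>n. ?t n) powr (1 / p) < (e powr p) powr (1 / p)"
    using p st by (intro powr_less_mono2 suminf_nonneg) auto
  then show ?thesis using p e by (auto simp: lp_norm_def powr_powr)
qed

lemma seq_space_lp:
  assumes "p \<ge> 1"
  shows "seq_space (lp p) (lp_norm p)"
proof (rule seq_space.intro)
  fix x assume "x \<in> lp p"
  then show "backward_shift x \<in> lp p"
    by (simp add: lp_def backward_shift_def summable_Suc_iff[of "\<lambda>n. norm (x n) powr p"])
qed (use assms Metric_space_lp subalgebra_lp lp_l1 lp_coord_le lp_null_seq lp_truncation in auto)

lemma seq_space_c0: "seq_space c0 c0_norm"
proof (rule seq_space.intro)
  fix x :: cseq
  assume x: "summable (\<lambda>n. norm (x n))"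
  show "x \<in> c0"
    using summable_LIMSEQ_zero[OF x] by (simp add: c0_def tendsto_norm_zero_iff)
  show "c0_norm x \<le> (\<Sum>n. norm (x n))"
    using sum_le_suminf[OF x, of "{n}" for n] by (intro c0_norm_least) simp
next
  fix x and e :: real assume x: "x \<in> c0" and e: "e > 0"
  then have "\<exists>m. \<forall>n\<ge>m. norm (x n - 0) < e / 2"
    unfolding c0_def by (intro LIMSEQ_D) auto
  then obtain m where m: "\<And>n. n \<ge> m \<Longrightarrow> norm (x n) < e / 2"
    by auto
  have "c0_norm (x - (\<lambda>n. if n < m then x n else 0)) \<le> e / 2"
    using m e by (intro c0_norm_least) (auto simp: not_less less_imp_le)
  then show "\<exists>m. c0_norm (x - (\<lambda>n. if n < m then x n else 0)) < e"
    using e by (intro exI[of _ m]) auto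
next
  fix x assume "x \<in> c0"
  then show "backward_shift x \<in> c0"
    by (auto simp: c0_def backward_shift_def intro: LIMSEQ_Suc)
qed (use Metric_space_c0 subalgebra_c0 c0_norm_upper in \<open>auto simp: c0_def\<close>)

section \<open>Hypercyclic vectors, weights and weight products\<close>

context seq_space
begin

lemma zero_mem: "0 \<in> X"
  and add_mem: "x \<in> X \<Longrightarrow> y \<in> X \<Longrightarrow> x + y \<in> X"
  and scale_mem: "x \<in> X \<Longrightarrow> (\<lambda>n. c * x n) \<in> X"
  using subalgebra by (auto simp: subalgebra_of_def)

lemma diff_mem: "x \<in> X \<Longrightarrow> y \<in> X \<Longrightarrow> x - y \<in> X"
  using add_mem[OF _ scale_mem[of y "- 1"], of x] by (simp add: plus_fun_def fun_diff_def)

lemma norm_diff_triangle: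
  assumes "x \<in> X" "y \<in> X" "z \<in> X"
  shows "N (x - z) \<le> N (x - y) + N (y - z)"
  using Metric_space.triangle[OF metric assms] assms by (simp add: norm_dist_def)

lemma truncate_mem: "(\<lambda>n. if n < m then x n else 0) \<in> X"
  by (intro l1_mem summable_finite[of "{..<m}"]) auto

text \<open>Invariance keeps the orbit in \<open>X\<close>, where \<open>norm_dist\<close> really is
  the distance given by \<open>N\<close>.\<close>

lemma HC_iff:
  assumes "T ` X \<subseteq> X"
  shows "x \<in> HC X N T \<longleftrightarrow> x \<in> X \<and> (\<forall>z\<in>X. \<forall>e>0. \<exists>k. N (z - (T ^^ k) x) < e)"
proof (cases "x \<in> X")
  case True
  have orbit: "(T ^^ k) x \<in> X" for k
    using True assms by (induction k) auto
  show ?thesis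
    unfolding HC_def norm_topology_def Metric_space.metric_closure_of[OF metric]
    using True orbit by (auto simp: Metric_space.in_mball[OF metric] norm_dist_def)
qed (simp add: HC_def)

text \<open>The diagonal map with entries v_j = w_1...w_j conjugates the weighted shift to the
  unweighted one; hence the ratios v_(k+j) / v_j.\<close>

lemma weighted_shift_funpow:
  assumes "weight w"
  shows "(weighted_shift w ^^ k) x =
    (\<lambda>j. (\<Prod>i=1..k + j. w i) / (\<Prod>i=1..j. w i) * x (k + j))"
proof (induction k)
  case 0
  then show ?case using assms by (auto simp: weight_def)
next
  case (Suc k)
  have "(\<Prod>i=1..j. w i) \<noteq> 0" for j using assms by (simp add: weight_def)
  then show ?case
    using assms unfolding funpow.simps o_apply Suc
    by (auto simp: weighted_shift_def weight_def fun_eq_iff)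
qed

text \<open>Otherwise |w| \<ge> 2^k at indices \<open>f k\<close>. The reciprocals of these weights
  form a summable sequence, hence a member of \<open>X\<close>, whose image has infinitely many
  entries 1 and so is not a null sequence.\<close>

lemma weight_bounded:
  assumes "weighted_shift_on X w"
  shows "\<exists>D. \<forall>n. norm (w n) \<le> D"
proof (rule ccontr)
  assume unb: "\<not> ?thesis"
  have large: "\<exists>n>m. norm (w n) \<ge> R" for m R
  proof (rule ccontr)
    assume "\<not> ?thesis"
    then have "norm (w n) \<le> max R (\<Sum>i\<le>m. norm (w i))" for n
    proof (cases "n \<le> m")
      case True
      then show ?thesis by (intro max.coboundedI2 member_le_sum) auto
    next
      case False
      with \<open>\<not> (\<exists>n>m. norm (w n) \<ge> R)\<close> show ?thesis
        by (intro max.coboundedI1) (meson linorder_le_cases not_le)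
    qed
    then show False using unb by blast
  qed
  have "\<exists>f. \<forall>k. (f k > 0 \<and> norm (w (f k)) \<ge> 2 ^ k) \<and> f k < f (Suc k)"
  proof (rule dependent_nat_choice)
    show "\<exists>n>0. norm (w n) \<ge> 2 ^ 0" using large by blast
  next
    fix m k assume "m > 0 \<and> norm (w m) \<ge> 2 ^ k"
    with large[of m "2 ^ Suc k"]
    show "\<exists>n. (n > 0 \<and> norm (w n) \<ge> 2 ^ Suc k) \<and> m < n" by (metis gr0I not_less_zero)
  qed
  then obtain f where f: "\<And>k. f k > 0" "\<And>k. norm (w (f k)) \<ge> 2 ^ k" "\<And>k. f k < f (Suc k)"
    by blast
  have sm: "strict_mono f" using f(3) by (simp add: strict_mono_Suc_iff)
  define x where "x n = (if n \<in> range f then 1 / w n else 0)" for n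
  have "summable (\<lambda>k. (1 / 2 :: real) ^ k)" by (rule summable_geometric) simp
  then have "summable (\<lambda>k. norm (x (f k)))"
  proof (rule summable_comparison_test'[of _ 0])
    fix k
    show "norm (norm (x (f k))) \<le> (1 / 2) ^ k"
      using frac_le[OF _ _ _ f(2)[of k], of 1 1] by (simp add: x_def norm_divide power_one_over)
  qed
  then have "summable (\<lambda>n. norm (x n))"
    by (subst summable_mono_reindex[OF sm, symmetric]) (auto simp: x_def)
  then have "weighted_shift w x \<in> X"
    using assms by (auto simp: weighted_shift_on_def dest: l1_mem)
  then have "weighted_shift w x \<longlonglongrightarrow> 0" by (rule null_seq)
  then have "(\<lambda>k. x k * w k) \<longlonglongrightarrow> 0"
    by (subst filterlim_sequentially_Suc[symmetric]) (simp add: weighted_shift_def mult.commute)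
  then have "(\<lambda>k. x (f k) * w (f k)) \<longlonglongrightarrow> 0"
    using LIMSEQ_subseq_LIMSEQ[OF _ sm] by (auto simp: o_def)
  moreover have "x (f k) * w (f k) = 1" for k
    using assms by (simp add: x_def weighted_shift_on_def weight_def)
  ultimately show False by (simp add: LIMSEQ_const_iff)
qed

text \<open>Approximating a large multiple of the indicator of \<^term>\<open>{..<L}\<close> by the orbit of a hypercyclic
  vector, whose entries are bounded, forces the weight products to be large.\<close>

lemma hypercyclic_weight_products:
  assumes w: "weighted_shift_on X w" and "hypercyclic X N (weighted_shift w)"
  shows "\<exists>n. \<forall>j<L. norm (\<Prod>i=1..n + j. w i) \<ge> R"
proof -
  from assms obtain x where "x \<in> HC X N (weighted_shift w)" by (auto simp: hypercyclic_def)
  moreover have maps: "weighted_shift w ` X \<subseteq> X" and wt: "weight w"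
    using w by (auto simp: weighted_shift_on_def)
  ultimately have x: "x \<in> X" and dense: "\<And>z e. z \<in> X \<Longrightarrow> e > 0 \<Longrightarrow> \<exists>k. N (z - (weighted_shift w ^^ k) x) < e"
    using HC_iff[OF maps] by auto
  define v where "v j = (\<Prod>i=1..j. w i)" for j
  have v0: "v j \<noteq> 0" for j using wt by (simp add: v_def weight_def)
  \<comment> \<open>Large enough that, after an approximation error of 1, at least |R| (N x + 1) /
    |v_j| is left for every j < L; the sum stands in for a maximum.\<close>
  define M where "M = 1 + (\<Sum>j<L. \<bar>R\<bar> * (N x + 1) / norm (v j))"
  have Nx: "N x \<ge> 0" using coord_le[OF x, of 0] norm_ge_zero[of "x 0"] by linarith
  let ?z = "\<lambda>n. if n < L then complex_of_real M else 0"
  obtain k where k: "N (?z - (weighted_shift w ^^ k) x) < 1"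
    using dense[OF truncate_mem, of 1 L "\<lambda>_. complex_of_real M"] by auto
  have orbit: "(weighted_shift w ^^ k) x \<in> X" for k
    using x maps by (induction k) auto
  have "norm (v (k + j)) \<ge> R" if j: "j < L" for j
  proof -
    have "norm (M - v (k + j) / v j * x (k + j)) < 1"
      using coord_le[OF diff_mem[OF truncate_mem orbit], of L "\<lambda>_. complex_of_real M" k j] k j
      by (simp add: weighted_shift_funpow[OF wt] v_def)
    then have "M - norm (v (k + j) / v j * x (k + j)) < 1"
      using norm_triangle_ineq2[of "complex_of_real M" "v (k + j) / v j * x (k + j)"]
        norm_of_real[of M, where 'a = complex] by linarith
    moreover have "\<bar>R\<bar> * (N x + 1) / norm (v j) \<le> M - 1"
      unfolding M_def using j Nx
        member_le_sum[of j "{..<L}" "\<lambda>j. \<bar>R\<bar> * (N x + 1) / norm (v j)"] by simp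
    ultimately have "\<bar>R\<bar> * (N x + 1) / norm (v j) \<le> norm (v (k + j)) * norm (x (k + j)) / norm (v j)"
      by (simp add: norm_mult norm_divide)
    then have "\<bar>R\<bar> * (N x + 1) \<le> norm (v (k + j)) * norm (x (k + j))"
      using v0[of j] by (simp add: divide_le_cancel)
    also have "\<dots> \<le> norm (v (k + j)) * (N x + 1)"
      using coord_le[OF x, of "k + j"] by (intro mult_left_mono) auto
    finally show ?thesis using Nx by simp
  qed
  then show ?thesis by (auto simp: v_def)
qed

end

section \<open>Complex roots, blocks and the block vector\<close>

text \<open>False for \<open>s < 1\<close>: dividing \<open>Ln u\<close> by \<open>s\<close> may then leave the principal branch.\<close>

lemma powr_inverse_powr:
  fixes u :: complex
  assumes "s \<ge> 1"
  shows "(u powr of_real (1 / s)) powr of_real s = u"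
proof (cases "u = 0")
  case False
  \<comment> \<open>Division by s \<ge> 1 keeps the imaginary part in (-pi, pi], so
    \<open>Ln\<close> undoes \<open>exp\<close> there.\<close>
  have "\<bar>Im (Ln u) / s\<bar> \<le> \<bar>Im (Ln u)\<bar>"
    using assms mult_right_mono[of 1 s "\<bar>Im (Ln u)\<bar>"] by (simp add: field_simps)
  moreover have "Im (Ln u) / s \<noteq> - pi"
  proof
    assume "Im (Ln u) / s = - pi"
    then have "Im (Ln u) = - pi * s" using assms by (simp add: field_simps)
    also have "\<dots> \<le> - pi" using assms by simp
    finally show False using mpi_less_Im_Ln[OF False] by simp
  qed
  ultimately have "- pi < Im (Ln u) / s" "Im (Ln u) / s \<le> pi"
    using mpi_less_Im_Ln[OF False] Im_Ln_le_pi[OF False] by linarith+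
  then have "Ln (exp (Ln u / of_real s)) = Ln u / of_real s"
    by (intro Ln_exp) (simp_all add: Im_divide_of_real)
  then show ?thesis using False assms by (simp add: powr_def)
qed simp

lemma block_index:
  fixes n :: "nat \<Rightarrow> nat"
  assumes "strict_mono n" "n 0 \<le> m"
  obtains k where "n k \<le> m" "m < n (Suc k)"
proof -
  define k where "k = (LEAST k. m < n (Suc k))"
  have "m < n (Suc m)" using seq_suble[OF assms(1), of "Suc m"] by simp
  then have "m < n (Suc k)" unfolding k_def by (rule LeastI)
  moreover have "n k \<le> m"
  proof (cases k)
    case (Suc i)
    then show ?thesis using not_less_Least[of i "\<lambda>k. m < n (Suc k)"] by (simp add: k_def)
  qed (use assms in simp)
  ultimately show thesis using that by blast
qed

lemma block_index_unique:
  fixes n :: "nat \<Rightarrow> nat"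
  assumes "strict_mono n" "n k \<le> m" "m < n (Suc k)"
  shows "(LEAST k. m < n (Suc k)) = k"
proof (rule Least_equality)
  fix i assume "m < n (Suc i)"
  then have "n k < n (Suc i)" using assms(2) by simp
  then show "k \<le> i" using assms(1) by (simp add: strict_mono_less)
qed (use assms in simp)

text \<open>As \<open>n\<close> is strictly increasing, the first M positions from
  \<open>n k\<close> on lie in the first M blocks, so bounds on block sums control all partial
  sums.\<close>

lemma suminf_block_le:
  fixes h :: "nat \<Rightarrow> real" and n :: "nat \<Rightarrow> nat"
  assumes n: "strict_mono n" and h: "\<And>m. h m \<ge> 0"
    and block: "\<And>i. i \<ge> k \<Longrightarrow> (\<Sum>m\<in>{n i..<n (Suc i)}. h m) \<le> a i"
    and bound: "\<And>K. (\<Sum>i\<in>{k..<K}. a i) \<le> E"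
  shows "summable (\<lambda>j. h (n k + j))" and "(\<Sum>j. h (n k + j)) \<le> E"
proof -
  have blocks: "(\<Sum>m\<in>{n k..<n (k + M)}. h m) \<le> (\<Sum>i\<in>{k..<k + M}. a i)" for M
  proof (induction M)
    case (Suc M)
    have "n k \<le> n (k + M)" "n (k + M) \<le> n (k + Suc M)"
      using n by (simp_all add: strict_mono_less_eq)
    then have "(\<Sum>m\<in>{n k..<n (k + Suc M)}. h m) =
        (\<Sum>m\<in>{n k..<n (k + M)}. h m) + (\<Sum>m\<in>{n (k + M)..<n (Suc (k + M))}. h m)"
      by (simp add: sum.atLeastLessThan_concat)
    then show ?case using Suc block[of "k + M"] by simp
  qed simp
  have le: "(\<Sum>j<M. h (n k + j)) \<le> E" for M
  proof -
    have "n k + M \<le> n (k + M)"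
      using n by (induction M) (auto intro: order.trans[OF _ Suc_leI[OF strict_monoD[OF n]]])
    have "(\<Sum>j<M. h (n k + j)) = (\<Sum>m\<in>{n k..<n k + M}. h m)"
      by (rule sum.reindex_bij_witness[of _ "\<lambda>m. m - n k" "\<lambda>j. n k + j"]) auto
    also have "\<dots> \<le> (\<Sum>m\<in>{n k..<n (k + M)}. h m)"
      using \<open>n k + M \<le> n (k + M)\<close> h by (intro sum_mono2) auto
    also have "\<dots> \<le> E" using blocks[of M] bound[of "k + M"] by simp
    finally show ?thesis .
  qed
  show "summable (\<lambda>j. h (n k + j))" by (rule summableI_nonneg_bounded[OF _ le]) (rule h)
  then show "(\<Sum>j. h (n k + j)) \<le> E" by (rule suminf_le_const) (rule le)
qed

lemma sum_half_power_le: "(\<Sum>i\<in>{k..<K}. (1 / 2 :: real) ^ i) \<le> 2 * (1 / 2) ^ k"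
proof (cases "k \<le> K")
  case True
  then have "(\<Sum>i\<in>{k..<K}. (1 / 2 :: real) ^ i) = 2 * (1 / 2) ^ k - 2 * (1 / 2) ^ K"
    by (induction K rule: dec_induct) simp_all
  then show ?thesis by simp
qed simp

lemma next_block:
  fixes v y :: "nat \<Rightarrow> complex"
  assumes v: "\<And>L R. \<exists>n. \<forall>j<L. norm (v (n + j)) \<ge> R" and s: "s \<ge> 1" and d: "d > 0"
  shows "\<exists>n>l. \<forall>j<L. norm (y j * v j / v (n + j)) powr (1 / s) \<le> d"
proof -
  define B where "B = (\<Sum>j<L. norm (y j * v j))"
  \<comment> \<open>The quotient brings the entries below d^s before the root is taken; the sum
    makes |v_n| exceed all |v_i| with i \<le> l, which forces n > l.\<close>
  define R where "R = 1 + B / d powr s + (\<Sum>i\<le>l. norm (v i))"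
  have B0: "B \<ge> 0" unfolding B_def by (intro sum_nonneg) auto
  have S0: "(\<Sum>i\<le>l. norm (v i)) \<ge> 0" by (intro sum_nonneg) auto
  have BR: "B / d powr s \<ge> 0" using B0 by simp
  have R0: "R > 0" "R \<ge> B / d powr s" "R > (\<Sum>i\<le>l. norm (v i))"
    using BR S0 by (auto simp: R_def)
  \<comment> \<open>One index more than \<open>L\<close>, so that j = 0 is available even if L =
    0.\<close>
  obtain n where n: "\<And>j. j < Suc L \<Longrightarrow> norm (v (n + j)) \<ge> R" using v[of "Suc L" R] by blast
  have "n > l"
  proof (rule ccontr)
    assume "\<not> n > l"
    then have "norm (v n) \<le> (\<Sum>i\<le>l. norm (v i))" by (intro member_le_sum) auto
    then show False using n[of 0] R0 by simp
  qed
  moreover have "norm (y j * v j / v (n + j)) powr (1 / s) \<le> d" if j: "j < L" for j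
  proof -
    have "norm (y j * v j) \<le> B" unfolding B_def using j by (intro member_le_sum) auto
    also have "B \<le> d powr s * R" using R0(2) d by (simp add: field_simps)
    also have "\<dots> \<le> d powr s * norm (v (n + j))" using n[of j] j by (intro mult_left_mono) auto
    finally have "norm (y j * v j / v (n + j)) \<le> d powr s"
      using n[of j] j R0(1) by (simp add: norm_divide divide_le_eq)
    then have "norm (y j * v j / v (n + j)) powr (1 / s) \<le> (d powr s) powr (1 / s)"
      using s by (intro powr_mono2) auto
    also have "\<dots> = d" using s d by (simp add: powr_powr)
    finally show ?thesis .
  qed
  ultimately show ?thesis by blast
qed

text \<open>On the \<open>k\<close>-th block the vector is an \<open>s k\<close>-th root of what the shift needs in order to
  reproduce \<open>y k\<close>. Its size there is measured against the length of the shift that belongs to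
  the preceding block.\<close>

lemma block_vector_exists:
  fixes v :: "nat \<Rightarrow> complex" and y :: "nat \<Rightarrow> nat \<Rightarrow> complex" and D :: real
  assumes v: "\<And>L R. \<exists>n. \<forall>j<L. norm (v (n + j)) \<ge> R" and v0: "\<And>j. v j \<noteq> 0"
    and s: "\<And>k. s k \<ge> 1" and y: "\<And>k j. j \<ge> L k \<Longrightarrow> y k j = 0" and D: "D \<ge> 1"
  obtains x n where "strict_mono n" "n 0 = 0"
    "\<And>k j. k > 0 \<Longrightarrow> j < n (Suc k) - n k \<Longrightarrow>
        v (n k + j) / v j * x (n k + j) powr of_real (s k) = y k j"
    "\<And>k. L k \<le> n (Suc k) - n k"
    "\<And>k. (\<Sum>m\<in>{n k..<n (Suc k)}. norm (x m)) \<le> (1 / 2) ^ k / D ^ n (k - 1)"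
proof -
  \<comment> \<open>Allowance for one entry of block k if the preceding block starts at m: at most
    \<open>L k\<close> such entries add up to no more than (1/2)^k / D^m. The + 1 avoids division by
    zero.\<close>
  define d where "d k m = (1 / 2) ^ k / D ^ m / (L k + 1)" for k m
  have d: "d k m > 0" for k m using D by (simp add: d_def)
  have "\<exists>n. \<forall>k. (k = 0 \<longrightarrow> n k = 0) \<and> (n k + L k < n (Suc k) \<and>
      (\<forall>j<L (Suc k). norm (y (Suc k) j * v j / v (n (Suc k) + j)) powr (1 / s (Suc k)) \<le> d (Suc k) (n k)))"
  proof (rule dependent_nat_choice)
    fix m k
    show "\<exists>n. (Suc k = 0 \<longrightarrow> n = 0) \<and> m + L k < n \<and>
      (\<forall>j<L (Suc k). norm (y (Suc k) j * v j / v (n + j)) powr (1 / s (Suc k)) \<le> d (Suc k) m)"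
      using next_block[OF v s d, where l = "m + L k"] by simp
  qed simp
  then obtain n where n0: "n 0 = 0" and nL: "\<And>k. n k + L k < n (Suc k)"
    and small: "\<And>k j. j < L (Suc k) \<Longrightarrow>
      norm (y (Suc k) j * v j / v (n (Suc k) + j)) powr (1 / s (Suc k)) \<le> d (Suc k) (n k)"
    by blast
  have sm: "strict_mono n" unfolding strict_mono_Suc_iff using nL by (metis add_lessD1)
  define b where "b m = (LEAST k. m < n (Suc k))" for m
  \<comment> \<open>Block 0 is left zero: its start is fixed at 0, where the weight products need
    not be large.\<close>
  define x where "x m = (if b m = 0 then 0 else
    (y (b m) (m - n (b m)) * v (m - n (b m)) / v m) powr of_real (1 / s (b m)))" for m
  have x: "x (n k + j) = (if k = 0 then 0 else (y k j * v j / v (n k + j)) powr of_real (1 / s k))"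
    if "j < n (Suc k) - n k" for k j
    using block_index_unique[OF sm, of k "n k + j"] that by (simp add: x_def b_def)
  show thesis
  proof
    fix k j assume kj: "k > 0" "j < n (Suc k) - n k"
    have "(x (n k + j)) powr of_real (s k) = y k j * v j / v (n k + j)"
      using kj(1) powr_inverse_powr[OF s, of _ k] unfolding x[OF kj(2)] by simp
    then show "v (n k + j) / v j * x (n k + j) powr of_real (s k) = y k j" using v0 by simp
  next
    fix k
    show "L k \<le> n (Suc k) - n k" using nL[of k] by simp
    have "(\<Sum>m\<in>{n k..<n (Suc k)}. norm (x m)) = (\<Sum>j<n (Suc k) - n k. norm (x (n k + j)))"
      by (rule sum.reindex_bij_witness[of _ "\<lambda>j. n k + j" "\<lambda>m. m - n k"]) auto
    also have "\<dots> = (\<Sum>j<L k. norm (x (n k + j)))"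
      using nL[of k] y by (intro sum.mono_neutral_right) (auto simp: x)
    also have "\<dots> \<le> (1 / 2) ^ k / D ^ n (k - 1)"
    proof (cases k)
      case 0
      then show ?thesis using nL[of k] D by (simp add: x)
    next
      case (Suc i)
      have "(\<Sum>j<L k. norm (x (n k + j))) \<le> (\<Sum>j<L k. d k (n i))"
        using nL[of k] small[of _ i] unfolding Suc
        by (intro sum_mono) (simp add: x norm_powr_real_powr')
      also have "\<dots> = real (L k) / (real (L k) + 1) * ((1 / 2) ^ k / D ^ n i)" by (simp add: d_def)
      also have "\<dots> \<le> 1 * ((1 / 2) ^ k / D ^ n i)"
        using D by (intro mult_right_mono) auto
      finally show ?thesis using Suc by simp
    qed
    finally show "(\<Sum>m\<in>{n k..<n (Suc k)}. norm (x m)) \<le> (1 / 2) ^ k / D ^ n (k - 1)" .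
  qed (use sm n0 in auto)
qed

section \<open>Hypercyclicity of the power combinations\<close>

context seq_space
begin

text \<open>After truncation only finitely many coordinates remain, and each z_j / c is approximated
  from the dense sequence. The factor c will be the coefficient of the least exponent, by which the
  orbit multiplies the prescribed sequence.\<close>

lemma dense_approximation:
  fixes d :: "nat \<Rightarrow> complex"
  assumes d: "\<And>z e. e > 0 \<Longrightarrow> \<exists>i. dist (d i) z < e"
    and z: "z \<in> X" and e: "e > 0" and c: "c \<noteq> 0"
  shows "\<exists>is. N (z - (\<lambda>j. c * (if j < length is then d (is ! j) else 0))) < e"
proof -
  obtain m where m: "N (z - (\<lambda>n. if n < m then z n else 0)) < e / 2"
    using truncation[OF z, of "e / 2"] e by auto
  \<comment> \<open>Errors of at most |c| r in m coordinates add up to less than e / 2.\<close>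
  define r where "r = e / (2 * (real m + 1) * norm c)"
  have r: "r > 0" using e c by (simp add: r_def)
  have "\<forall>j. \<exists>i. dist (d i) (z j / c) < r" using d[OF r] by blast
  then obtain i where i: "\<And>j. dist (d (i j)) (z j / c) < r" by metis
  define f where "f = (\<lambda>n. if n < m then z n else 0) -
    (\<lambda>j. c * (if j < length (map i [0..<m]) then d (map i [0..<m] ! j) else 0))"
  have f0: "f j = 0" if "j \<notin> {..<m}" for j using that by (simp add: f_def)
  have "norm (f j) \<le> norm c * r" if "j < m" for j
  proof -
    have "f j = c * (z j / c - d (i j))" using that c by (simp add: f_def field_simps)
    then have "norm (f j) = norm c * dist (d (i j)) (z j / c)"
      by (simp add: norm_mult dist_norm norm_minus_commute)
    then show ?thesis using i[of j] by (simp add: mult_left_mono)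
  qed
  then have "(\<Sum>j<m. norm (f j)) \<le> (\<Sum>j<m. norm c * r)" by (intro sum_mono) auto
  also have "\<dots> = real m / (real m + 1) * (e / 2)" using c by (simp add: r_def)
  also have "\<dots> < 1 * (e / 2)" using e by (intro mult_strict_right_mono) auto
  finally have "(\<Sum>j<m. norm (f j)) < e / 2" by simp
  moreover have "(\<Sum>j. norm (f j)) = (\<Sum>j<m. norm (f j))"
    using f0 by (intro suminf_finite) auto
  moreover have "summable (\<lambda>j. norm (f j))"
    by (rule summable_finite[of "{..<m}"]) (use f0 in auto)
  ultimately have "N f < e / 2" using l1_norm[of f] by simp
  have mem: "(\<lambda>j. c * (if j < length (map i [0..<m]) then d (map i [0..<m] ! j) else 0)) \<in> X"
    by (intro scale_mem truncate_mem)
  have "N (z - (\<lambda>j. c * (if j < length (map i [0..<m]) then d (map i [0..<m] ! j) else 0)))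
      \<le> N (z - (\<lambda>n. if n < m then z n else 0)) + N f"
    unfolding f_def by (rule norm_diff_triangle[OF z truncate_mem mem])
  then show ?thesis using m \<open>N f < e / 2\<close> by (intro exI[of _ "map i [0..<m]"]) simp
qed

end

text \<open>Rationality makes the exponents countable. The bound 1 gives |x_m|^q \<le> |x_m| when
  |x_m| \<le> 1, makes the roots invertible, and keeps sums of two exponents at or above 2.\<close>

definition rational_exponents :: "real set" where
  "rational_exponents = {q \<in> \<rat>. q \<ge> 1}"

definition power_combination :: "cseq \<Rightarrow> real set \<Rightarrow> (real \<Rightarrow> complex) \<Rightarrow> cseq" where
  "power_combination x F c = (\<lambda>m. \<Sum>q\<in>F. c q * x m powr of_real q)"

lemma norm_power_combination_le:
  assumes "F \<subseteq> rational_exponents" "norm (x m) \<le> 1"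
  shows "norm (power_combination x F c m) \<le> (\<Sum>q\<in>F. norm (c q)) * norm (x m)"
proof -
  have "norm (power_combination x F c m) \<le> (\<Sum>q\<in>F. norm (c q) * norm (x m))"
    unfolding power_combination_def
  proof (rule sum_norm_le)
    fix q assume "q \<in> F"
    then have q: "q \<ge> 1" using assms(1) by (auto simp: rational_exponents_def)
    then have "norm (x m) powr q \<le> norm (x m) powr 1"
      using assms(2) by (intro powr_mono') auto
    then show "norm (c q * x m powr of_real q) \<le> norm (c q) * norm (x m)"
      by (simp add: norm_mult norm_powr_real_powr' mult_left_mono)
  qed
  then show ?thesis by (simp add: sum_distrib_right)
qed

text \<open>The discarded first component of the decoded pair runs through all naturals, so every
  value recurs infinitely often.\<close>

lemma frequent_enumeration:
  fixes a :: "'a :: countable"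
  shows "\<exists>k\<ge>l. snd (from_nat k :: nat \<times> 'a) = a"
proof -
  have "inj (\<lambda>i::nat. to_nat (i, a))" by (auto intro!: injI)
  then have "infinite (range (\<lambda>i::nat. to_nat (i, a)))" by (rule range_inj_infinite)
  then obtain i :: nat where "to_nat (i, a) \<ge> l"
    by (auto simp: infinite_nat_iff_unbounded_le)
  then show ?thesis by (intro exI[of _ "to_nat (i, a)"]) simp
qed

text \<open>The ratio is the product of the k weights w_(j+1), ..., w_(j+k).\<close>

lemma norm_ratio_weight_products_le:
  fixes w :: cseq
  assumes "weight w" "\<And>i. norm (w i) \<le> D" "D \<ge> 1"
  shows "norm ((\<Prod>i=1..k + j. w i) / (\<Prod>i=1..j. w i)) \<le> D ^ k"
proof (induction k)
  case 0
  then show ?case using assms(1) by (auto simp: weight_def)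
next
  case (Suc k)
  have "norm ((\<Prod>i=1..Suc k + j. w i) / (\<Prod>i=1..j. w i)) =
      norm ((\<Prod>i=1..k + j. w i) / (\<Prod>i=1..j. w i)) * norm (w (Suc (k + j)))"
    by (simp add: norm_mult norm_divide)
  also have "\<dots> \<le> D ^ k * D" using assms(3) by (intro mult_mono Suc assms(2)) auto
  finally show ?case by (simp add: mult.commute)
qed

context seq_space
begin

text \<open>Assuming large weight products instead of hypercyclicity lets the construction also
  prove the Rolewicz operators hypercyclic. One \<open>x\<close> serves all \<open>c\<close>, since
  the density of the targets absorbs the coefficients.\<close>

proposition hypercyclic_combinations:
  assumes w: "weighted_shift_on X w"
    and unbounded: "\<And>L R. \<exists>n. \<forall>j<L. norm (\<Prod>i=1..n + j. w i) \<ge> R"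
  obtains x where "\<And>F c. finite F \<Longrightarrow> F \<noteq> {} \<Longrightarrow> F \<subseteq> rational_exponents \<Longrightarrow>
    (\<And>q. q \<in> F \<Longrightarrow> c q \<noteq> 0) \<Longrightarrow> power_combination x F c \<in> HC X N (weighted_shift w)"
proof -
  have wt: "weight w" and maps: "weighted_shift w ` X \<subseteq> X"
    using w by (auto simp: weighted_shift_on_def)
  obtain D where D: "D \<ge> 1" "\<And>n. norm (w n) \<le> D"
    using weight_bounded[OF w] by (metis linorder_le_cases order_trans)
  define v where "v j = (\<Prod>i=1..j. w i)" for j
  have v0: "v j \<noteq> 0" for j using wt by (simp add: v_def weight_def)
  have vD: "norm (v (k + j) / v j) \<le> D ^ k" for k j
    unfolding v_def by (rule norm_ratio_weight_products_le[OF wt D(2,1)])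
  obtain E :: "complex set" where E: "countable E" "\<And>U. open U \<Longrightarrow> U \<noteq> {} \<Longrightarrow> \<exists>z\<in>E. z \<in> U"
    by (metis countable_dense_setE)
  have "E \<noteq> {}" using E(2)[of UNIV] by auto
  define d where "d = from_nat_into E"
  have dense: "\<exists>i. dist (d i) z < e" if "e > 0" for z e
  proof -
    from E(2)[of "ball z e"] that obtain a where "a \<in> E" "dist z a < e" by auto
    then show ?thesis
      using from_nat_into_surj[OF E(1)] by (metis d_def dist_commute)
  qed
  \<comment> \<open>A code consists of an exponent and a list of indices into the dense sequence.
    Below, \<open>max 1\<close> makes every code admissible without changing exponents that are at
    least 1.\<close>
  define code where "code k = snd (from_nat k :: nat \<times> rat \<times> nat list)" for k
  define s :: "nat \<Rightarrow> real" where "s k = max 1 (of_rat (fst (code k)))" for k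
  define L where "L k = length (snd (code k))" for k
  define y where "y k j = (if j < L k then d (snd (code k) ! j) else 0)" for k j
  have s1: "s k \<ge> 1" for k by (simp add: s_def)
  obtain x n where n: "strict_mono n" "n 0 = 0"
    and main: "\<And>k j. k > 0 \<Longrightarrow> j < n (Suc k) - n k \<Longrightarrow>
        v (n k + j) / v j * x (n k + j) powr of_real (s k) = y k j"
    and long: "\<And>k. L k \<le> n (Suc k) - n k"
    and small: "\<And>k. (\<Sum>m\<in>{n k..<n (Suc k)}. norm (x m)) \<le> (1 / 2) ^ k / D ^ n (k - 1)"
  proof (rule block_vector_exists[of v s L y D, OF unbounded[folded v_def] v0 s1 _ D(1)])
    show "y k j = 0" if "j \<ge> L k" for k j using that by (simp add: y_def)
  qed blast
  have small': "(\<Sum>m\<in>{n k..<n (Suc k)}. norm (x m)) \<le> (1 / 2) ^ k" for k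
  proof -
    have "(1 / 2 :: real) ^ k / D ^ n (k - 1) \<le> (1 / 2) ^ k"
      using D(1) by (simp add: divide_le_eq mult_le_cancel_left1)
    with small[of k] show ?thesis by linarith
  qed
  have x_block: "norm (x m) \<le> (1 / 2) ^ k" if "n k \<le> m" "m < n (Suc k)" for k m
    using small'[of k] member_le_sum[of m "{n k..<n (Suc k)}" "\<lambda>m. norm (x m)"] that by simp
  have x1: "norm (x m) \<le> 1" for m
  proof -
    obtain k where "n k \<le> m" "m < n (Suc k)" using block_index[OF n(1), of m] n(2) by auto
    from x_block[OF this] show ?thesis using power_le_one[of "1 / 2 :: real" k] by linarith
  qed
  show thesis
  proof
    fix F :: "real set" and c :: "real \<Rightarrow> complex"
    assume F: "finite F" "F \<noteq> {}" "F \<subseteq> rational_exponents" and c: "\<And>q. q \<in> F \<Longrightarrow> c q \<noteq> 0"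
    define P where "P = power_combination x F c"
    define K where "K = (\<Sum>q\<in>F. norm (c q))"
    have K0: "K \<ge> 0" unfolding K_def by (intro sum_nonneg) auto
    have P_le: "norm (P m) \<le> K * norm (x m)" for m
      unfolding P_def K_def by (rule norm_power_combination_le[where x=x and m=m, OF F(3) x1])
    \<comment> \<open>The block sums of \<open>P\<close> decay geometrically, so \<open>P\<close> is
      absolutely summable and lies in \<open>X\<close>.\<close>
    have "summable (\<lambda>j. norm (P (n 0 + j)))"
    proof (rule suminf_block_le(1)[OF n(1)])
      fix i
      have "(\<Sum>m\<in>{n i..<n (Suc i)}. norm (P m)) \<le> K * (\<Sum>m\<in>{n i..<n (Suc i)}. norm (x m))"
        unfolding sum_distrib_left by (intro sum_mono P_le)
      also have "\<dots> \<le> K * (1 / 2) ^ i" using small' K0 by (intro mult_left_mono) auto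
      finally show "(\<Sum>m\<in>{n i..<n (Suc i)}. norm (P m)) \<le> K * (1 / 2) ^ i" .
    next
      fix M show "(\<Sum>i\<in>{0..<M}. K * (1 / 2) ^ i) \<le> K * (2 * (1 / 2) ^ 0)"
        unfolding sum_distrib_left[symmetric] by (intro mult_left_mono sum_half_power_le K0)
    qed auto
    then have PX: "P \<in> X" by (intro l1_mem) (simp add: n(2))
    define t where "t = Min F"
    have t: "t \<in> F" "\<And>q. q \<in> F \<Longrightarrow> t \<le> q" using F by (auto simp: t_def)
    have "t \<in> \<rat>" and t1: "t \<ge> 1" using F(3) t(1) by (auto simp: rational_exponents_def)
    then obtain r where r: "t = of_rat r" by (auto elim: Rats_cases)
    have "\<exists>k. N (z - (weighted_shift w ^^ k) P) < e" if z: "z \<in> X" and e: "e > 0" for z e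
    proof -
      obtain ys where ys: "N (z - (\<lambda>j. c t * (if j < length ys then d (ys ! j) else 0))) < e / 2"
        using dense_approximation[OF dense z, of "e / 2" "c t"] e c[OF t(1)] by auto
      define u where "u j = (if j < length ys then d (ys ! j) else 0)" for j
      define Y where "Y = (\<Sum>j<length ys. norm (u j))"
      \<comment> \<open>Bound for the l^1 error: the sum comes from the higher powers on block k,
        the last term from the later blocks. Both tend to 0.\<close>
      define B where "B k = (\<Sum>q\<in>F - {t}. norm (c q) * Y * ((1 / 2) powr (q - t)) ^ k) + K * (2 * (1 / 2) ^ k)" for k
      have powers: "(\<lambda>k. ((1 / 2 :: real) powr (q - t)) ^ k) \<longlonglongrightarrow> 0" if "q \<in> F - {t}" for q
      proof (rule LIMSEQ_realpow_zero)
        have "q > t" using that t(2)[of q] by auto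
        then show "(1 / 2 :: real) powr (q - t) < 1" using powr_less_mono2[of "q - t" "1 / 2" 1] by simp
      qed simp
      moreover have "(\<lambda>k. (1 / 2 :: real) ^ k) \<longlonglongrightarrow> 0"
        by (rule LIMSEQ_realpow_zero) auto
      ultimately have "(\<lambda>k. B k) \<longlonglongrightarrow> (\<Sum>q\<in>F - {t}. norm (c q) * Y * 0) + K * (2 * 0)"
        unfolding B_def by (intro tendsto_add tendsto_sum tendsto_mult tendsto_const powers)
      then have "eventually (\<lambda>k. B k < e / 2) sequentially"
        using e by (intro order_tendstoD(2)) auto
      then obtain l where l: "\<And>k. k \<ge> l \<Longrightarrow> B k < e / 2" by (auto simp: eventually_sequentially)
      \<comment> \<open>\<open>Suc l\<close> ensures k > 0, which excludes the zero block.\<close>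
      obtain k where k: "k \<ge> Suc l" "code k = (r, ys)"
        using frequent_enumeration[of "Suc l" "(r, ys)"] by (auto simp: code_def)
      have sk: "s k = t" and yk: "y k = u" and Lk: "L k = length ys"
        using k(2) r t1 by (auto simp: s_def y_def u_def L_def fun_eq_iff)
      define f where "f = (\<lambda>j. c t * u j) - (weighted_shift w ^^ n k) P"
      have f: "f j = c t * u j - v (n k + j) / v j * P (n k + j)" for j
        by (simp add: f_def weighted_shift_funpow[OF wt] v_def)
      \<comment> \<open>On block k the exponent t yields c_t u_j exactly. For q > t, |a|^q = |a|^t
        |a|^(q-t) with |a| \<le> (1/2)^k, which leaves a small multiple of |u_j|.\<close>
      have first: "norm (f j) \<le> (\<Sum>q\<in>F - {t}. norm (c q) * norm (u j) * ((1 / 2) powr (q - t)) ^ k)"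
        if j: "j < n (Suc k) - n k" for j
      proof -
        define a where "a = x (n k + j)"
        have eq: "v (n k + j) / v j * a powr of_real t = u j"
          using main[OF _ j] k(1) by (simp add: sk yk a_def)
        have "v (n k + j) / v j * P (n k + j) = (\<Sum>q\<in>F. c q * (v (n k + j) / v j * a powr of_real q))"
          by (simp add: P_def power_combination_def a_def sum_distrib_left sum_divide_distrib mult_ac)
        also have "\<dots> = c t * u j + (\<Sum>q\<in>F - {t}. c q * (v (n k + j) / v j * a powr of_real q))"
          using F(1) t(1) by (simp only: sum.remove eq)
        finally have "norm (f j) = norm (\<Sum>q\<in>F - {t}. c q * (v (n k + j) / v j * a powr of_real q))"
          by (simp only: f) (simp add: norm_minus_commute)
        also have "\<dots> \<le> (\<Sum>q\<in>F - {t}. norm (c q) * norm (u j) * ((1 / 2) powr (q - t)) ^ k)"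
        proof (rule sum_norm_le)
          fix q assume q: "q \<in> F - {t}"
          then have qt: "q > t" using t(2)[of q] by auto
          have "norm (a powr of_real q) = norm (a powr of_real t) * norm a powr (q - t)"
            using powr_add[of "norm a" t "q - t"] by (simp add: norm_powr_real_powr')
          then have "norm (v (n k + j) / v j * a powr of_real q) =
              norm (v (n k + j) / v j * a powr of_real t) * norm a powr (q - t)"
            by (simp only: norm_mult mult.assoc)
          also have "\<dots> = norm (u j) * norm a powr (q - t)" by (simp only: eq)
          also have "norm a powr (q - t) \<le> ((1 / 2) ^ k) powr (q - t)"
            using x_block[of k "n k + j"] j qt by (intro powr_mono2) (auto simp: a_def)
          also have "((1 / 2) ^ k) powr (q - t) = ((1 / 2 :: real) powr (q - t)) ^ k"
            by (simp add: powr_powr powr_power mult.commute flip: powr_realpow)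
          finally have "norm (v (n k + j) / v j * a powr of_real q) \<le> norm (u j) * ((1 / 2) powr (q - t)) ^ k"
            by (simp add: mult_left_mono)
          then show "norm (c q * (v (n k + j) / v j * a powr of_real q)) \<le>
              norm (c q) * norm (u j) * ((1 / 2) powr (q - t)) ^ k"
            unfolding norm_mult[of "c q"] mult.assoc[of "norm (c q)"] by (rule mult_left_mono) simp
        qed
        finally show ?thesis .
      qed
      define h where "h m = norm (f (m - n k))" for m
      \<comment> \<open>\<open>B k\<close> minus its last term is the sum over the higher powers.
        The geometric term is the bound for i > k and mere slack at i = k.\<close>
      have block: "(\<Sum>m\<in>{n i..<n (Suc i)}. h m) \<le>
          (if i = k then B k - K * (2 * (1 / 2) ^ k) else 0) + K * (1 / 2) ^ i" if i: "i \<ge> k" for i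
      proof (cases "i = k")
        case True
        have "(\<Sum>m\<in>{n k..<n (Suc k)}. h m) = (\<Sum>j<n (Suc k) - n k. norm (f j))"
          unfolding h_def by (rule sum.reindex_bij_witness[of _ "\<lambda>j. n k + j" "\<lambda>m. m - n k"]) auto
        also have "\<dots> \<le> (\<Sum>j<n (Suc k) - n k. \<Sum>q\<in>F - {t}. norm (c q) * norm (u j) * ((1 / 2) powr (q - t)) ^ k)"
          using first by (intro sum_mono) auto
        also have "\<dots> = (\<Sum>q\<in>F - {t}. norm (c q) * (\<Sum>j<n (Suc k) - n k. norm (u j)) * ((1 / 2) powr (q - t)) ^ k)"
          by (subst sum.swap) (simp add: sum_distrib_left sum_distrib_right)
        also have "(\<Sum>j<n (Suc k) - n k. norm (u j)) = Y"
          unfolding Y_def using long[of k] by (intro sum.mono_neutral_right) (auto simp: u_def Lk)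
        finally show ?thesis using True K0 by (simp add: B_def add_increasing2)
      next
        case False
        then have ki: "k < i" using i by simp
        have nki: "n (Suc k) \<le> n i" "n k \<le> n (i - 1)" "n k \<le> n i"
          using ki n(1) by (auto simp: strict_mono_less_eq)
        have "h m \<le> D ^ n k * K * norm (x m)" if m: "m \<in> {n i..<n (Suc i)}" for m
        proof -
          have "u (m - n k) = 0" using m nki long[of k] by (auto simp: u_def Lk)
          then have "h m = norm (v (n k + (m - n k)) / v (m - n k)) * norm (P m)"
            using m nki by (simp add: h_def f norm_mult norm_divide)
          also have "\<dots> \<le> D ^ n k * (K * norm (x m))"
            using D(1) by (intro mult_mono vD P_le) auto
          finally show ?thesis by simp
        qed
        then have "(\<Sum>m\<in>{n i..<n (Suc i)}. h m) \<le> (\<Sum>m\<in>{n i..<n (Suc i)}. D ^ n k * K * norm (x m))"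
          by (rule sum_mono)
        also have "\<dots> = D ^ n k * K * (\<Sum>m\<in>{n i..<n (Suc i)}. norm (x m))"
          by (simp add: sum_distrib_left)
        \<comment> \<open>The shift by \<open>n k\<close> amplifies by at most D^(n k) \<le> D^(n (i
          - 1)), as k \<le> i - 1; the denominator in \<open>small\<close> cancels this.\<close>
        also have "\<dots> \<le> D ^ n (i - 1) * K * ((1 / 2) ^ i / D ^ n (i - 1))"
          using D(1) K0 nki small[of i] by (intro mult_mono power_increasing) (auto intro: sum_nonneg)
        also have "\<dots> = K * (1 / 2) ^ i" using D(1) by simp
        finally show ?thesis using False by simp
      qed
      have bound: "(\<Sum>i\<in>{k..<M}. (if i = k then B k - K * (2 * (1 / 2) ^ k) else 0) + K * (1 / 2) ^ i) \<le> B k" for M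
      proof -
        have Y0: "Y \<ge> 0" unfolding Y_def by (intro sum_nonneg) auto
        have "B k - K * (2 * (1 / 2) ^ k) \<ge> 0"
          unfolding B_def using Y0 by (auto intro!: sum_nonneg)
        then have "(\<Sum>i\<in>{k..<M}. (if i = k then B k - K * (2 * (1 / 2) ^ k) else 0)) \<le> B k - K * (2 * (1 / 2) ^ k)"
          by (simp add: sum.delta)
        moreover have "(\<Sum>i\<in>{k..<M}. K * (1 / 2) ^ i) \<le> K * (2 * (1 / 2) ^ k)"
          unfolding sum_distrib_left[symmetric] by (intro mult_left_mono sum_half_power_le K0)
        ultimately show ?thesis by (simp only: sum.distrib)
      qed
      have h_shift: "h (n k + j) = norm (f j)" for j by (simp add: h_def)
      have "h m \<ge> 0" for m by (simp add: h_def)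
      note tail = suminf_block_le[OF n(1) this block bound, unfolded h_shift]
      have "N f \<le> B k" using l1_norm[OF tail(1)] tail(2) by linarith
      then have "N f < e / 2" using l[of k] k(1) by simp
      have orbit: "(weighted_shift w ^^ i) P \<in> X" for i
        using PX maps by (induction i) auto
      have "(\<lambda>j. c t * u j) \<in> X" unfolding u_def by (intro scale_mem truncate_mem)
      from norm_diff_triangle[OF z this orbit[of "n k"]] \<open>N f < e / 2\<close> ys
      have "N (z - (weighted_shift w ^^ n k) P) < e" by (simp add: f_def u_def)
      then show ?thesis by blast
    qed
    then show "power_combination x F c \<in> HC X N (weighted_shift w)"
      using PX HC_iff[OF maps] by (simp add: P_def)
  qed
qed

text \<open>The orbit of 0 stays at 0, at distance at least 1 from the first unit vector.\<close>

lemma zero_not_HC: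
  assumes "weighted_shift w ` X \<subseteq> X" "weight w"
  shows "0 \<notin> HC X N (weighted_shift w)"
proof
  assume "0 \<in> HC X N (weighted_shift w)"
  moreover have z: "(\<lambda>n. if n < 1 then 1 else 0) \<in> X" by (rule truncate_mem)
  ultimately obtain k where "N ((\<lambda>n. if n < 1 then 1 else 0) - (weighted_shift w ^^ k) 0) < 1"
    using HC_iff[OF assms(1)] zero_less_one by blast
  moreover have "(weighted_shift w ^^ k) 0 = 0"
    by (simp add: weighted_shift_funpow[OF assms(2)] fun_eq_iff)
  ultimately show False using coord_le[OF z, of 0] by simp
qed

end

section \<open>The span of the powers of one sequence\<close>

text \<open>Exponents may repeat and coefficients may vanish, so closure properties are plain
  inductions; \<open>power_span_combination\<close> supplies a normal form.\<close>

inductive_set power_span :: "cseq \<Rightarrow> real set \<Rightarrow> cseq set" for x T where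
  zero: "0 \<in> power_span x T"
| add: "q \<in> T \<Longrightarrow> a \<in> power_span x T \<Longrightarrow> (\<lambda>m. c * x m powr of_real q) + a \<in> power_span x T"

lemma power_span_monomial: "q \<in> T \<Longrightarrow> (\<lambda>m. c * x m powr of_real q) \<in> power_span x T"
  using power_span.add[OF _ power_span.zero, of q T c x] by simp

lemma power_span_add:
  "a \<in> power_span x T \<Longrightarrow> b \<in> power_span x T \<Longrightarrow> a + b \<in> power_span x T"
  by (induction rule: power_span.induct) (auto simp: add.assoc intro: power_span.add)

lemma power_span_scale: "a \<in> power_span x T \<Longrightarrow> (\<lambda>m. b * a m) \<in> power_span x T"
proof (induction rule: power_span.induct)
  case zero
  then show ?case using power_span.zero by (simp add: zero_fun_def)
next
  case (add q a c)
  then show ?case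
    using power_span.add[OF add(1,3), of "b * c"] by (simp add: plus_fun_def algebra_simps)
qed

text \<open>Powers of one complex number, taken with the same branch, multiply by adding exponents;
  this also holds at 0, where all powers are 0.\<close>

lemma power_span_mult:
  assumes T: "\<And>q r. q \<in> T \<Longrightarrow> r \<in> T \<Longrightarrow> q + r \<in> T"
    and a: "a \<in> power_span x T" and b: "b \<in> power_span x T"
  shows "a * b \<in> power_span x T"
  using a
proof (induction rule: power_span.induct)
  case (add q a c)
  have "(\<lambda>m. c * x m powr of_real q) * b \<in> power_span x T"
    using b
  proof (induction rule: power_span.induct)
    case (add r b d)
    have eq: "(\<lambda>m. c * x m powr of_real q) * ((\<lambda>m. d * x m powr of_real r) + b) =
        (\<lambda>m. (c * d) * x m powr of_real (q + r)) + (\<lambda>m. c * x m powr of_real q) * b"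
      by (simp add: fun_eq_iff powr_add distrib_left)
    show ?case
      unfolding eq by (rule power_span.add[OF T[OF \<open>q \<in> T\<close> add(1)] add(3)])
  qed (simp only: mult_zero_right power_span.zero)
  then show ?case unfolding distrib_right by (rule power_span_add[OF _ add(3)])
qed (simp only: mult_zero_left power_span.zero)

lemma power_span_mono: "T \<subseteq> U \<Longrightarrow> power_span x T \<subseteq> power_span x U"
proof
  fix a assume "T \<subseteq> U" "a \<in> power_span x T"
  from this(2,1) show "a \<in> power_span x U"
    by induction (auto intro: power_span.intros)
qed

lemma power_span_finite_support:
  "a \<in> power_span x T \<Longrightarrow> \<exists>F\<subseteq>T. finite F \<and> a \<in> power_span x F"
proof (induction rule: power_span.induct)
  case zero
  then show ?case using power_span.zero by blast
next
  case (add q a c)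
  then obtain F where F: "F \<subseteq> T" "finite F" "a \<in> power_span x F" by blast
  have "a \<in> power_span x (insert q F)"
    using F(3) power_span_mono[of F "insert q F" x] by blast
  then have "(\<lambda>m. c * x m powr of_real q) + a \<in> power_span x (insert q F)"
    by (intro power_span.add) auto
  with F add(1) show ?case by (metis finite_insert insert_subset)
qed

text \<open>Coefficients of equal exponents are merged and zero ones dropped, to match the form in
  which combinations are known to be hypercyclic.\<close>

lemma power_span_combination:
  assumes "a \<in> power_span x T"
  obtains F c where "finite F" "F \<subseteq> T" "\<And>q. q \<in> F \<Longrightarrow> c q \<noteq> 0" "a = power_combination x F c"
proof -
  from assms have "\<exists>F c. finite F \<and> F \<subseteq> T \<and> a = power_combination x F c"
  proof (induction rule: power_span.induct)
    case zero
    show ?case by (intro exI[of _ "{}"]) (auto simp: power_combination_def fun_eq_iff)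
  next
    case (add q a b)
    then obtain F c where F: "finite F" "F \<subseteq> T" "a = power_combination x F c" by blast
    define c' where "c' r = (if r \<in> F then c r else 0) + (if r = q then b else 0)" for r
    have "(\<lambda>m. b * x m powr of_real q) + a = power_combination x (insert q F) c'"
    proof
      fix m
      have 1: "(\<Sum>r\<in>insert q F. (if r \<in> F then c r else 0) * x m powr of_real r) = a m"
        unfolding F(3) power_combination_def using F(1)
        by (intro sum.mono_neutral_cong_right) auto
      have 2: "(\<Sum>r\<in>insert q F. (if r = q then b else 0) * x m powr of_real r) = b * x m powr of_real q"
        using F(1) by (subst sum.mono_neutral_right[of _ "{q}"]) auto
      show "((\<lambda>m. b * x m powr of_real q) + a) m = power_combination x (insert q F) c' m"
        unfolding power_combination_def c'_def distrib_right sum.distrib 1 2 by simp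
    qed
    with F add(1) show ?case by (intro exI[of _ "insert q F"] exI[of _ c']) auto
  qed
  then obtain F c where F: "finite F" "F \<subseteq> T" "a = power_combination x F c" by blast
  have "a = power_combination x {q \<in> F. c q \<noteq> 0} c"
    unfolding F(3) power_combination_def
    by (intro ext sum.mono_neutral_right) (use F(1) in auto)
  with F(1,2) show thesis by (intro that[of "{q \<in> F. c q \<noteq> 0}" c]) auto
qed

section \<open>Algebrability from large weight products\<close>

context seq_space
begin

lemma power_span_subalgebra:
  assumes "\<And>q r. q \<in> T \<Longrightarrow> r \<in> T \<Longrightarrow> q + r \<in> T" "power_span x T \<subseteq> X"
  shows "subalgebra_of X (power_span x T)"
  unfolding subalgebra_of_def
  using assms power_span.zero power_span_add power_span_scale power_span_mult by blast

text \<open>Finitely many elements only involve a finite set \<open>F\<close> of exponents. The exponents in \<open>F\<close>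
  or at least 2 are closed under addition, since all exponents are at least 1; but they miss some
  exponent strictly between 1 and 2.\<close>

lemma algebrable_of_unbounded_products:
  assumes w: "weighted_shift_on X w"
    and unbounded: "\<And>L R. \<exists>n. \<forall>j<L. norm (\<Prod>i=1..n + j. w i) \<ge> R"
  shows "algebrable X (HC X N (weighted_shift w))" and "hypercyclic X N (weighted_shift w)"
proof -
  obtain x where x: "\<And>F c. finite F \<Longrightarrow> F \<noteq> {} \<Longrightarrow> F \<subseteq> rational_exponents \<Longrightarrow>
      (\<And>q. q \<in> F \<Longrightarrow> c q \<noteq> 0) \<Longrightarrow> power_combination x F c \<in> HC X N (weighted_shift w)"
    using hypercyclic_combinations[OF w unbounded] by blast
  have "power_combination x {1} (\<lambda>_. 1) \<in> HC X N (weighted_shift w)"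
    by (rule x) (auto simp: rational_exponents_def)
  then show "hypercyclic X N (weighted_shift w)" by (auto simp: hypercyclic_def)
  have no_zero: "0 \<notin> HC X N (weighted_shift w)"
    using w zero_not_HC by (auto simp: weighted_shift_on_def)
  let ?A = "power_span x rational_exponents"
  have A_HC: "?A \<subseteq> HC X N (weighted_shift w) \<union> {0}"
  proof
    fix a assume "a \<in> ?A"
    then obtain F c where F: "finite F" "F \<subseteq> rational_exponents" "\<And>q. q \<in> F \<Longrightarrow> c q \<noteq> 0"
      and a: "a = power_combination x F c"
      by (rule power_span_combination) blast
    show "a \<in> HC X N (weighted_shift w) \<union> {0}"
    proof (cases "F = {}")
      case True
      then show ?thesis by (simp add: a power_combination_def zero_fun_def)
    next
      case False
      then show ?thesis using x[OF F(1) False F(2,3)] by (simp add: a)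
    qed
  qed
  also have "\<dots> \<subseteq> X" using zero_mem by (auto simp: HC_def)
  finally have AX: "?A \<subseteq> X" .
  have sub: "subalgebra_of X ?A"
    by (rule power_span_subalgebra[OF _ AX]) (auto simp: rational_exponents_def)
  have not_fg: "\<not> (\<exists>G\<subseteq>X. finite G \<and> ?A = algebra_generated X G)"
  proof
    assume "\<exists>G\<subseteq>X. finite G \<and> ?A = algebra_generated X G"
    then obtain G where G: "finite G" "?A = algebra_generated X G" by blast
    then have "G \<subseteq> ?A" by (simp add: algebra_generated_def hull_subset)
    then have "\<forall>g\<in>G. \<exists>F. F \<subseteq> rational_exponents \<and> finite F \<and> g \<in> power_span x F"
      using power_span_finite_support by blast
    then obtain supp where supp: "\<And>g. g \<in> G \<Longrightarrow> supp g \<subseteq> rational_exponents"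
        "\<And>g. g \<in> G \<Longrightarrow> finite (supp g)" "\<And>g. g \<in> G \<Longrightarrow> g \<in> power_span x (supp g)"
      by metis
    define F where "F = (\<Union>g\<in>G. supp g)"
    define T where "T = F \<union> {q \<in> \<rat>. q \<ge> 2}"
    have FT: "F \<subseteq> rational_exponents" "finite F" using supp G(1) by (auto simp: F_def)
    then have T: "T \<subseteq> rational_exponents" by (auto simp: T_def rational_exponents_def)
    have "G \<subseteq> power_span x T"
      using supp(3) power_span_mono[of "supp g" T x for g] by (auto simp: T_def F_def)
    moreover have "subalgebra_of X (power_span x T)"
    proof (rule power_span_subalgebra)
      fix q r assume "q \<in> T" "r \<in> T"
      then have "q \<in> rational_exponents" "r \<in> rational_exponents" using T by auto
      then show "q + r \<in> T" by (auto simp: T_def rational_exponents_def)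
    qed (use AX power_span_mono[OF T] in blast)
    ultimately have AT: "?A \<subseteq> power_span x T"
      unfolding G(2) algebra_generated_def by (rule hull_minimal)
    \<comment> \<open>Infinitely many rationals strictly between 1 and 2, of which the finite set
      \<open>F\<close> misses one.\<close>
    have "infinite ((\<lambda>n::nat. 1 + 1 / real (n + 2)) ` UNIV)"
      by (rule range_inj_infinite) (auto intro!: injI)
    then obtain n :: nat where n: "1 + 1 / real (n + 2) \<notin> F"
      using FT(2) by (meson finite_subset image_subsetI)
    define r where "r = 1 + 1 / real (n + 2)"
    have r: "r \<in> rational_exponents" "r \<notin> T"
      using n by (auto simp: r_def T_def rational_exponents_def field_simps)
    have "(\<lambda>m. 1 * x m powr of_real r) \<in> ?A" by (rule power_span_monomial[OF r(1)])
    with AT have "(\<lambda>m. 1 * x m powr of_real r) \<in> power_span x T" by (rule subsetD)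
    then obtain F' c where F': "finite F'" "F' \<subseteq> T" "\<And>q. q \<in> F' \<Longrightarrow> c q \<noteq> 0"
      and eq: "(\<lambda>m. 1 * x m powr of_real r) = power_combination x F' c"
      by (rule power_span_combination) blast
    have "r \<notin> F'" using r F' by auto
    \<comment> \<open>The representation of x^r by exponents in \<open>T\<close>, minus x^r itself,
      is 0; yet as a combination with nonzero coefficients it would be hypercyclic.\<close>
    have "power_combination x (insert r F') (c(r := - 1)) = 0"
    proof
      fix m
      have "(\<Sum>q\<in>F'. (c(r := - 1)) q * x m powr of_real q) = (\<Sum>q\<in>F'. c q * x m powr of_real q)"
        using \<open>r \<notin> F'\<close> by (intro sum.cong) auto
      also have "\<dots> = x m powr of_real r"
        using fun_cong[OF eq, of m] by (simp add: power_combination_def)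
      finally show "power_combination x (insert r F') (c(r := - 1)) m = 0 m"
        using F'(1) \<open>r \<notin> F'\<close> by (simp add: power_combination_def)
    qed
    moreover have "power_combination x (insert r F') (c(r := - 1)) \<in> HC X N (weighted_shift w)"
      using F' r(1) T by (intro x) auto
    ultimately show False using no_zero by simp
  qed
  \<comment> \<open>The algebra serves as its own generating set; were it finite, it would be
    finitely generated.\<close>
  have gen: "?A = algebra_generated X ?A"
    using hull_same[of "subalgebra_of X", OF sub] by (simp add: algebra_generated_def)
  have "infinite ?A" using not_fg gen AX by blast
  then show "algebrable X (HC X N (weighted_shift w))"
    unfolding algebrable_def using sub A_HC not_fg gen AX by blast
qed

end

section \<open>Rolewicz operators and the conclusion\<close>

text \<open>Entry 0 follows the convention for weights; the shift never reads it.\<close>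

lemma rolewicz_eq_weighted_shift: "rolewicz c = weighted_shift ((\<lambda>_. c)(0 := 1))"
  by (simp add: fun_eq_iff rolewicz_def weighted_shift_def backward_shift_def)

text \<open>The products are powers of c, of modulus at least |c|^n for all j at once.\<close>

lemma rolewicz_weight_products:
  fixes c :: complex and L :: nat
  assumes "norm c > 1"
  shows "\<exists>n. \<forall>j<L. norm (\<Prod>i=1..n + j. ((\<lambda>_. c)(0 := 1)) i) \<ge> R"
proof -
  obtain n where n: "R < norm c ^ n" using real_arch_pow[OF assms] by blast
  have le: "R \<le> norm (\<Prod>i=1..n + j. ((\<lambda>_. c)(0 := 1)) i)" for j
  proof -
    have "(\<Prod>i=1..n + j. ((\<lambda>_. c)(0 := 1)) i) = (\<Prod>i=1..n + j. c)" by (intro prod.cong) auto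
    moreover have "norm c ^ n \<le> norm c ^ (n + j)" using assms by (intro power_increasing) auto
    ultimately show ?thesis using n by (simp add: norm_power)
  qed
  show ?thesis by (intro exI[of _ n] allI impI le)
qed

theorem corollary2p8:
  fixes X :: "cseq set" and N :: "cseq \<Rightarrow> real"
  assumes "lp_or_c0 X N"
  shows "(\<forall>w. weighted_shift_on X w \<and> hypercyclic X N (weighted_shift w) \<longrightarrow>
            algebrable X (HC X N (weighted_shift w))) \<and>
         (\<forall>c :: complex. norm c > 1 \<longrightarrow>
            (\<exists>w. weighted_shift_on X w \<and> weighted_shift w = rolewicz c) \<and>
            hypercyclic X N (rolewicz c) \<and>
            algebrable X (HC X N (rolewicz c)))"
proof -
  interpret seq_space X N
    using assms seq_space_lp seq_space_c0 by (auto simp: lp_or_c0_def)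
  show ?thesis
  proof (intro conjI allI impI)
    fix w assume "weighted_shift_on X w \<and> hypercyclic X N (weighted_shift w)"
    then show "algebrable X (HC X N (weighted_shift w))"
      using algebrable_of_unbounded_products(1) hypercyclic_weight_products by blast
  next
    fix c :: complex assume c: "norm c > 1"
    let ?w = "(\<lambda>_. c)(0 := 1)"
    have "rolewicz c ` X \<subseteq> X"
      unfolding rolewicz_def using shift_mem scale_mem by auto
    then have w: "weighted_shift_on X ?w"
      using c unfolding rolewicz_eq_weighted_shift by (auto simp: weighted_shift_on_def weight_def)
    then show "\<exists>w. weighted_shift_on X w \<and> weighted_shift w = rolewicz c"
      using rolewicz_eq_weighted_shift by metis
    show "hypercyclic X N (rolewicz c)" "algebrable X (HC X N (rolewicz c))"
      unfolding rolewicz_eq_weighted_shift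
      by (rule algebrable_of_unbounded_products[OF w rolewicz_weight_products[OF c]])+
  qed
qed

end
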